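(* Let $h \geq 2$ be an integer, $\omega := \exp(2\pi \mathrm{i}/h)$, and let $A \in M_n(\mathbb{C})$ be nonsingular and $h$-cyclic with consecutive ordered partition $\Pi = (\pi_1,\dots,\pi_h)$ of $\{1,\dots,n\}$, so that $A$ has the block form $$A=\begin{bmatrix} 0 & A_{12} & 0 & \cdots & 0\\ 0 & 0 & A_{23} & \ddots & \vdots\\ \vdots & \vdots & \ddots & \ddots & 0\\ 0 & 0 & \cdots & 0 & A_{(h-1)h}\\ A_{h1} & 0 & 0 & \cdots & 0\end{bmatrix}.$$ For $i,j \in \mathbb{Z}$, let $\alpha_{ij} := (i-j) \bmod h \in \{0,1,\dots,h-1\}$. (1) If $\{x_{\langle 0,j\rangle}\}_{j=1}^r$ is a right Jordan chain of $A$ corresponding to $\lambda \in \sigma(A)$, where each $x_{\langle 0,j\rangle}$ is partitioned conformably with $A$ as $$x_{\langle 0,j\rangle} = \begin{bmatrix} x_{1j}\\ x_{2j}\\ \vdots\\ x_{hj}\end{bmatrix},\quad j=1,\dots,r,$$ then for every $k \in \{0,1,\dots,h-1\}$ the set $$\left\{ x_{\langle k,j\rangle} := \begin{bmatrix} (\omega^k)^{\alpha_{1j}} x_{1j}\\ (\omega^k)^{\alpha_{2j}} x_{2j}\\ \vdots\\ (\omega^k)^{\alpha_{hj}} x_{hj}\end{bmatrix}\right\}_{j=1}^r$$ is a right Jordan chain of $A$ corresponding to $\lambda\omega^k$. (2) If $\{y_{\langle j,0\rangle}\}_{j=1}^r$ is a left Jordan chain of $A$ corresponding to $\lambda \in \sigma(A)$,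 where each $y_{\langle j,0\rangle}$ is partitioned conformably with $A$ as $$y_{\langle j,0\rangle}^\top = \begin{bmatrix} y_{j1}^\top & y_{j2}^\top & \cdots & y_{jh}^\top\end{bmatrix},\quad j=1,\dots,r,$$ then for every $k \in \{0,1,\dots,h-1\}$ the set $$\left\{ y_{\langle j,k\rangle}^\top := \begin{bmatrix} (\omega^k)^{\alpha_{j1}} y_{j1}^\top & (\omega^k)^{\alpha_{j2}} y_{j2}^\top & \cdots & (\omega^k)^{\alpha_{jh}} y_{jh}^\top\end{bmatrix}\right\}_{j=1}^r$$ is a left Jordan chain of $A$ corresponding to $\lambda\omega^k$.
   Context: $M_n(\mathbb{C})$ is the algebra of complex $n\times n$ matrices and $\sigma(A)$ is the spectrum of $A$. A matrix $A=[a_{ij}] \in M_n(\mathbb{C})$ is $h$-cyclic with ordered partition $\Pi=(\pi_1,\dots,\pi_h)$ of $\{1,\dots,n\}$ into $h$ nonempty subsets if, whenever $a_{ij}\neq 0$, there is $\ell\in\{1,\dots,h\}$ with $i\in\pi_\ell$ and $j\in\pi_{\ell+1}$ (where $\pi_{h+1}:=\pi_1$). The partition is consecutive if $\pi_1=\{1,\dots,i_1\}$, $\pi_2=\{i_1+1,\dots,i_2\}$, ..., $\pi_h=\{i_{h-1}+1,\dots,n\}$; in this case $A$ has the displayed block form, where $A_{\ell(\ell+1)}$ is the submatrix of $A$ with rows indexed by $\pi_\ell$ and columns indexed by $\pi_{\ell+1}$. "Partitioned conformably with $A$" means that the $i$-th block of the vector consists of the entries indexed by $\pi_i$. A right Jordan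 chain of $A$ corresponding to $\lambda$ is a sequence of vectors $x_1,\dots,x_r$ with $x_1\neq 0$, $Ax_1=\lambda x_1$, and $Ax_j = x_{j-1}+\lambda x_j$ for $j=2,\dots,r$. A left Jordan chain of $A$ corresponding to $\lambda$ is a sequence of vectors $y_1,\dots,y_r$ with $y_r\neq 0$, $y_r^\top A=\lambda y_r^\top$, and $y_j^\top A = \lambda y_j^\top + y_{j+1}^\top$ for $j=1,\dots,r-1$ (so the eigenvector is the last vector). The sets in the statement are understood as sequences ordered by $j$. *)

theory Defs
  imports "Jordan_Normal_Form.Spectral_Radius"
begin

text \<open>Rows, columns and vector entries are numbered from 0 (the convention of the matrix library),
  so the index set is \<open>{0..<n}\<close>. Block numbers run over \<open>1, \<dots>, h\<close> and chain positions over
  \<open>1, \<dots>, r\<close>.\<close>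

definition ordered_partition :: "nat \<Rightarrow> nat \<Rightarrow> (nat \<Rightarrow> nat set) \<Rightarrow> bool" where
  "ordered_partition n h \<pi> \<longleftrightarrow>
     (\<forall>l\<in>{1..h}. \<pi> l \<noteq> {}) \<and>
     (\<forall>l\<in>{1..h}. \<forall>m\<in>{1..h}. l \<noteq> m \<longrightarrow> \<pi> l \<inter> \<pi> m = {}) \<and>
     (\<Union>l\<in>{1..h}. \<pi> l) = {0..<n}"

definition consecutive_partition :: "nat \<Rightarrow> nat \<Rightarrow> (nat \<Rightarrow> nat set) \<Rightarrow> bool" where
  "consecutive_partition n h \<pi> \<longleftrightarrow>
     ordered_partition n h \<pi> \<and>
     (\<exists>s :: nat \<Rightarrow> nat. s 0 = 0 \<and> s h = n \<and> (\<forall>l\<in>{1..h}. \<pi> l = {s (l - 1)..<s l}))"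

definition h_cyclic :: "nat \<Rightarrow> nat \<Rightarrow> (nat \<Rightarrow> nat set) \<Rightarrow> complex mat \<Rightarrow> bool" where
  "h_cyclic n h \<pi> A \<longleftrightarrow>
     A \<in> carrier_mat n n \<and> ordered_partition n h \<pi> \<and>
     (\<forall>i<n. \<forall>j<n. A $$ (i, j) \<noteq> 0 \<longrightarrow>
        (\<exists>l\<in>{1..h}. i \<in> \<pi> l \<and> j \<in> \<pi> (if l = h then 1 else l + 1)))"

definition right_jordan_chain ::
  "complex mat \<Rightarrow> complex \<Rightarrow> nat \<Rightarrow> (nat \<Rightarrow> complex vec) \<Rightarrow> bool" where
  "right_jordan_chain A \<mu> r x \<longleftrightarrow>
     1 \<le> r \<and> (\<forall>j\<in>{1..r}. x j \<in> carrier_vec (dim_row A)) \<and>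
     x 1 \<noteq> 0\<^sub>v (dim_row A) \<and> A *\<^sub>v x 1 = \<mu> \<cdot>\<^sub>v x 1 \<and>
     (\<forall>j\<in>{2..r}. A *\<^sub>v x j = x (j - 1) + \<mu> \<cdot>\<^sub>v x j)"

text \<open>\<open>mat_of_row y\<close> is the row vector \<open>y\<^sup>T\<close>.\<close>

definition left_jordan_chain ::
  "complex mat \<Rightarrow> complex \<Rightarrow> nat \<Rightarrow> (nat \<Rightarrow> complex vec) \<Rightarrow> bool" where
  "left_jordan_chain A \<mu> r y \<longleftrightarrow>
     1 \<le> r \<and> (\<forall>j\<in>{1..r}. y j \<in> carrier_vec (dim_row A)) \<and>
     y r \<noteq> 0\<^sub>v (dim_row A) \<and> mat_of_row (y r) * A = \<mu> \<cdot>\<^sub>m mat_of_row (y r) \<and>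
     (\<forall>j\<in>{1..<r}. mat_of_row (y j) * A = \<mu> \<cdot>\<^sub>m mat_of_row (y j) + mat_of_row (y (j + 1)))"

text \<open>The column vector obtained by stacking the blocks \<open>b 1, \<dots>, b h\<close>.\<close>

definition stack_vec :: "nat \<Rightarrow> (nat \<Rightarrow> complex vec) \<Rightarrow> complex vec" where
  "stack_vec h b = foldr (\<lambda>l v. b l @\<^sub>v v) [1..<h + 1] vNil"

text \<open>Since the \<open>\<pi> l\<close> are consecutive intervals, the blocks of a vector are determined by their
  lengths: block \<open>l\<close> consists of the entries of the vector indexed by \<open>\<pi> l\<close>.\<close>

definition partitioned_conformably ::
  "nat \<Rightarrow> (nat \<Rightarrow> nat set) \<Rightarrow> complex vec \<Rightarrow> (nat \<Rightarrow> complex vec) \<Rightarrow> bool" where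
  "partitioned_conformably h \<pi> v b \<longleftrightarrow>
     (\<forall>l\<in>{1..h}. b l \<in> carrier_vec (card (\<pi> l))) \<and> v = stack_vec h b"

definition cyc_diff :: "nat \<Rightarrow> int \<Rightarrow> int \<Rightarrow> nat" where
  "cyc_diff h i j = nat ((i - j) mod int h)"

end

theory Submission
  imports Defs
begin

text \<open>If \<open>z ^ h = 1\<close> and \<open>D\<close> is the diagonal matrix with the scalar \<open>z ^ l\<close> on block \<open>l\<close>, then
  \<open>h\<close>-cyclicity gives \<open>A D = z D A\<close>. The right chain in question is \<open>z\<^sup>-\<^sup>j D x\<^sub>j\<close>,
  the left chain is \<open>z\<^sup>j D\<inverse> y\<^sub>j\<close>, so the Jordan chain equations for \<open>\<mu>\<close> turn into
  those for \<open>\<mu> z\<close>.\<close>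

text \<open>Downward induction on \<open>m\<close>, prepending one block at a time. The stack of
  blocks \<open>m + 1\<close> to \<open>h\<close> starts at global position \<open>s m\<close>, so
  that offset is subtracted from a global index \<open>i\<close>. The bounds
  \<open>s m \<le> i\<close> and \<open>i < s h\<close> travel with the claim because subtraction on
  \<open>nat\<close> truncates. Only the case \<open>m = 0\<close> is used later.\<close>

lemma stack_from_index:
  fixes s :: "nat \<Rightarrow> nat" and b :: "nat \<Rightarrow> complex vec"
  assumes "m \<le> h"
    and mono: "\<And>l. l \<in> {1..h} \<Longrightarrow> s (l - 1) \<le> s l"
    and b: "\<And>l. l \<in> {1..h} \<Longrightarrow> dim_vec (b l) = s l - s (l - 1)"
  shows "s m \<le> s h \<and> dim_vec (foldr (\<lambda>l v. b l @\<^sub>v v) [m + 1..<h + 1] vNil) = s h - s m \<and>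
    (\<forall>l i. m < l \<longrightarrow> l \<le> h \<longrightarrow> s (l - 1) \<le> i \<longrightarrow> i < s l \<longrightarrow>
      s m \<le> i \<and> i < s h \<and>
      foldr (\<lambda>l v. b l @\<^sub>v v) [m + 1..<h + 1] vNil $ (i - s m) = b l $ (i - s (l - 1)))"
  using \<open>m \<le> h\<close>
proof (induction m rule: inc_induct)
  case base
  show ?case by simp
next
  case (step m)
  define v where "v = foldr (\<lambda>l v. b l @\<^sub>v v) [Suc m + 1..<h + 1] vNil"
  have sm: "s m \<le> s (Suc m)" using mono[of "Suc m"] step.hyps by auto
  have dim_b: "dim_vec (b (Suc m)) = s (Suc m) - s m" using b[of "Suc m"] step.hyps by auto
  have IH: "s (Suc m) \<le> s h" "dim_vec v = s h - s (Suc m)"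
    "\<And>l i. Suc m < l \<Longrightarrow> l \<le> h \<Longrightarrow> s (l - 1) \<le> i \<Longrightarrow> i < s l \<Longrightarrow>
      s (Suc m) \<le> i \<and> i < s h \<and> v $ (i - s (Suc m)) = b l $ (i - s (l - 1))"
    using step.IH unfolding v_def by blast+
  have cons: "[m + 1..<h + 1] = Suc m # [Suc m + 1..<h + 1]"
    using step.hyps by (simp add: upt_conv_Cons)
  have fold_eq: "foldr (\<lambda>l v. b l @\<^sub>v v) [m + 1..<h + 1] vNil = b (Suc m) @\<^sub>v v"
    unfolding cons v_def by simp
  have "s m \<le> i \<and> i < s h \<and> (b (Suc m) @\<^sub>v v) $ (i - s m) = b l $ (i - s (l - 1))"
    if l: "m < l" "l \<le> h" "s (l - 1) \<le> i" "i < s l" for l i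
  proof (cases "l = Suc m")
    case True
    then show ?thesis using l IH(1,2) dim_b by (auto simp: index_append_vec)
  next
    case False
    with l IH(3)[of l i] have "s (Suc m) \<le> i" "i < s h"
      and eq: "v $ (i - s (Suc m)) = b l $ (i - s (l - 1))" by auto
    \<comment> \<open>Past the first block, appending shifts the index by the length of that block;
      the two offsets combine because \<open>s m \<le> s (Suc m) \<le> i\<close>, so nothing is
      truncated.\<close>
    moreover have "i - s m - (s (Suc m) - s m) = i - s (Suc m)"
      using sm \<open>s (Suc m) \<le> i\<close> by simp
    ultimately show ?thesis
      using sm IH(2) dim_b by (auto simp: index_append_vec)
  qed
  then show ?case unfolding fold_eq using sm IH(1,2) dim_b by auto
qed

text \<open>Scaling leaves block lengths unchanged, so both stacks read position \<open>i\<close> at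
  the same place of the same block. This replaces blockwise scaling by entrywise scaling.\<close>

lemma consecutive_partition_stack_vec:
  assumes "consecutive_partition n h \<pi>"
    and b: "\<And>l. l \<in> {1..h} \<Longrightarrow> b l \<in> carrier_vec (card (\<pi> l))"
  shows "stack_vec h b \<in> carrier_vec n"
    and "l \<in> {1..h} \<Longrightarrow> i \<in> \<pi> l \<Longrightarrow> stack_vec h (\<lambda>l. c l \<cdot>\<^sub>v b l) $ i = c l * stack_vec h b $ i"
proof -
  obtain s where s: "s 0 = 0" "s h = n" "\<And>l. l \<in> {1..h} \<Longrightarrow> \<pi> l = {s (l - 1)..<s l}"
    and part: "ordered_partition n h \<pi>"
    using assms(1) unfolding consecutive_partition_def by auto
  \<comment> \<open>Monotonicity comes from nonemptiness of the blocks: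
    \<open>{s (l - 1)..<s l}\<close> would be empty otherwise.\<close>
  have step: "s (l - 1) \<le> s l" if "l \<in> {1..h}" for l
    using part s(3)[OF that] that unfolding ordered_partition_def by fastforce
  have b': "dim_vec (b l) = s l - s (l - 1)" if "l \<in> {1..h}" for l
    using b[OF that] s(3)[OF that] by auto
  have cb: "dim_vec (c l \<cdot>\<^sub>v b l) = s l - s (l - 1)" if "l \<in> {1..h}" for l
    using b'[OF that] by simp
  \<comment> \<open>Kept general in \<open>b\<close>, since it is needed for the given blocks and
    for the scaled ones.\<close>
  have st: "dim_vec (stack_vec h b) = n \<and> (\<forall>l i. 0 < l \<longrightarrow> l \<le> h \<longrightarrow> s (l - 1) \<le> i \<longrightarrow> i < s l \<longrightarrow>
      stack_vec h b $ i = b l $ (i - s (l - 1)))"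
    if "\<And>l. l \<in> {1..h} \<Longrightarrow> dim_vec (b l) = s l - s (l - 1)" for b :: "nat \<Rightarrow> complex vec"
    using stack_from_index[of 0 h s b] step that s(1,2) by (simp add: stack_vec_def)
  show "stack_vec h b \<in> carrier_vec n"
    using st[of b] b' by (intro carrier_vecI) blast
  show "stack_vec h (\<lambda>l. c l \<cdot>\<^sub>v b l) $ i = c l * stack_vec h b $ i"
    if "l \<in> {1..h}" "i \<in> \<pi> l"
  proof -
    have i: "0 < l" "l \<le> h" "s (l - 1) \<le> i" "i < s l" using that s(3) by auto
    have "stack_vec h (\<lambda>l. c l \<cdot>\<^sub>v b l) $ i = (c l \<cdot>\<^sub>v b l) $ (i - s (l - 1))"
      using st[of "\<lambda>l. c l \<cdot>\<^sub>v b l"] cb i by blast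
    also have "\<dots> = c l * b l $ (i - s (l - 1))"
      using b'[OF that(1)] i by simp
    also have "b l $ (i - s (l - 1)) = stack_vec h b $ i"
      using st[of b] b' i by metis
    finally show ?thesis .
  qed
qed

text \<open>Exponents of \<open>z\<close> only matter modulo \<open>h\<close>. Passing to integer
  exponents lets the factor split into a part depending on the block and a part depending on the
  chain position.\<close>

lemma power_cyc_diff:
  fixes z :: complex
  assumes "h > 0" and z: "z ^ h = 1"
  shows "z ^ cyc_diff h i j = z powi (i - j)"
proof -
  have nz: "z \<noteq> 0" using assms by (auto simp: power_0_left)
  have "z powi (i - j) = z powi (int h * ((i - j) div int h) + (i - j) mod int h)" by simp
  also have "\<dots> = z powi ((i - j) mod int h)"
    using nz z by (subst power_int_add) (simp_all add: power_int_mult)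
  also have "\<dots> = z ^ cyc_diff h i j"
    using \<open>h > 0\<close> by (simp add: cyc_diff_def power_int_def)
  finally show ?thesis by simp
qed

text \<open>With \<open>D\<close> the diagonal matrix of the \<open>u i\<close>, the twine
  hypothesis reads \<open>A D = z D A\<close>. Hence \<open>A\<close> sends
  \<open>z^(-j) D x_j\<close> to \<open>z^(1-j) D (A x_j)\<close>, and expanding
  \<open>A x_j\<close> gives \<open>\<mu> z\<close> times the same vector plus
  \<open>z^(-(j-1)) D x_(j-1)\<close>, the preceding vector of the new chain.\<close>

lemma right_jordan_chain_scale:
  assumes A: "A \<in> carrier_mat n n" and "z \<noteq> 0" and u: "\<And>i. i < n \<Longrightarrow> u i \<noteq> 0"
    and twine: "\<And>i m. i < n \<Longrightarrow> m < n \<Longrightarrow> A $$ (i, m) * u m = z * u i * A $$ (i, m)"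
    and chain: "right_jordan_chain A \<mu> r x"
    and x': "\<And>j. j \<in> {1..r} \<Longrightarrow> x' j = vec n (\<lambda>i. z powi (- int j) * u i * x j $ i)"
  shows "right_jordan_chain A (\<mu> * z) r x'"
proof -
  have r: "1 \<le> r" and car: "\<And>j. j \<in> {1..r} \<Longrightarrow> x j \<in> carrier_vec n"
    and x1: "x 1 \<noteq> 0\<^sub>v n" "A *\<^sub>v x 1 = \<mu> \<cdot>\<^sub>v x 1"
    and xj: "\<And>j. j \<in> {2..r} \<Longrightarrow> A *\<^sub>v x j = x (j - 1) + \<mu> \<cdot>\<^sub>v x j"
    using chain A unfolding right_jordan_chain_def by auto
  have mult: "(A *\<^sub>v x' j) $ i = z * z powi (- int j) * u i * (A *\<^sub>v x j) $ i"
    if "j \<in> {1..r}" "i < n" for i j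
  proof -
    have "(A *\<^sub>v x' j) $ i = (\<Sum>m<n. A $$ (i, m) * (z powi (- int j) * u m * x j $ m))"
      using A that x' by (simp add: scalar_prod_def lessThan_atLeast0)
    also have "\<dots> = (\<Sum>m<n. z * z powi (- int j) * u i * (A $$ (i, m) * x j $ m))"
    proof (rule sum.cong)
      fix m assume "m \<in> {..<n}"
      then have "z powi (- int j) * x j $ m * (A $$ (i, m) * u m) =
          z powi (- int j) * x j $ m * (z * u i * A $$ (i, m))"
        using twine[of i m] that(2) by simp
      then show "A $$ (i, m) * (z powi (- int j) * u m * x j $ m) =
          z * z powi (- int j) * u i * (A $$ (i, m) * x j $ m)"
        by (simp only: mult_ac)
    qed simp
    also have "\<dots> = z * z powi (- int j) * u i * (A *\<^sub>v x j) $ i"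
      using A that car[OF that(1)]
      by (simp add: scalar_prod_def lessThan_atLeast0 sum_distrib_left)
    finally show ?thesis .
  qed
  obtain i where i: "i < n" "x 1 $ i \<noteq> 0"
    using x1(1) car[of 1] r by (metis atLeastAtMost_iff carrier_vecD eq_vecI index_zero_vec le_refl)
  have "x' 1 $ i \<noteq> 0" using i x'[of 1] r u \<open>z \<noteq> 0\<close> by simp
  then have ne: "x' 1 \<noteq> 0\<^sub>v n" using i by auto
  have first: "A *\<^sub>v x' 1 = (\<mu> * z) \<cdot>\<^sub>v x' 1"
  proof (rule eq_vecI)
    fix i assume "i < dim_vec ((\<mu> * z) \<cdot>\<^sub>v x' 1)"
    then have "i < n" using x'[of 1] r by simp
    then show "(A *\<^sub>v x' 1) $ i = ((\<mu> * z) \<cdot>\<^sub>v x' 1) $ i"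
      using mult[of 1 i] r x1(2) x'[of 1] car[of 1] by simp
  qed (use A x'[of 1] r in simp)
  have later: "A *\<^sub>v x' j = x' (j - 1) + (\<mu> * z) \<cdot>\<^sub>v x' j" if j: "j \<in> {2..r}" for j
  proof (rule eq_vecI)
    have j': "j \<in> {1..r}" "j - 1 \<in> {1..r}" using j by auto
    fix i assume "i < dim_vec (x' (j - 1) + (\<mu> * z) \<cdot>\<^sub>v x' j)"
    then have i: "i < n" using x'[OF j'(1)] by simp
    \<comment> \<open>The surplus factor \<open>z\<close> from the twine relation turns the weight
      of position \<open>j\<close> into that of position \<open>j - 1\<close>;
      \<open>j \<ge> 2\<close> keeps \<open>j - 1\<close> from truncating.\<close>
    have "z * z powi (- int j) = z powi (1 + (- int j))"
      using \<open>z \<noteq> 0\<close> by (subst power_int_add) auto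
    then have "z * z powi (- int j) = z powi (- int (j - 1))"
      using j' by (simp add: of_nat_diff)
    then show "(A *\<^sub>v x' j) $ i = (x' (j - 1) + (\<mu> * z) \<cdot>\<^sub>v x' j) $ i"
      using mult[OF j'(1) i] i xj[OF j] x'[OF j'(1)] x'[OF j'(2)] car[OF j'(1)] car[OF j'(2)]
      by (simp add: algebra_simps)
  qed (use A x'[of j] j in simp)
  show ?thesis
    unfolding right_jordan_chain_def using A r x' ne first later by auto
qed

text \<open>From \<open>A D = z D A\<close> follows \<open>D^(-1) A = z A D^(-1)\<close>, so rows
  are weighted by the inverses of the \<open>u i\<close>. Left chains step from \<open>j\<close> to
  \<open>j + 1\<close>, hence the weight \<open>z^j\<close> instead of
  \<open>z^(-j)\<close>.\<close>

lemma left_jordan_chain_scale: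
  assumes A: "A \<in> carrier_mat n n" and "z \<noteq> 0" and u: "\<And>i. i < n \<Longrightarrow> u i \<noteq> 0"
    and twine: "\<And>i m. i < n \<Longrightarrow> m < n \<Longrightarrow> A $$ (i, m) * u m = z * u i * A $$ (i, m)"
    and chain: "left_jordan_chain A \<mu> r y"
    and y': "\<And>j. j \<in> {1..r} \<Longrightarrow> y' j = vec n (\<lambda>i. z powi int j / u i * y j $ i)"
  shows "left_jordan_chain A (\<mu> * z) r y'"
proof -
  have r: "1 \<le> r" and car: "\<And>j. j \<in> {1..r} \<Longrightarrow> y j \<in> carrier_vec n"
    and yr: "y r \<noteq> 0\<^sub>v n" "mat_of_row (y r) * A = \<mu> \<cdot>\<^sub>m mat_of_row (y r)"
    and yj: "\<And>j. j \<in> {1..<r} \<Longrightarrow>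
      mat_of_row (y j) * A = \<mu> \<cdot>\<^sub>m mat_of_row (y j) + mat_of_row (y (j + 1))"
    using chain A unfolding left_jordan_chain_def by auto
  have mult: "(mat_of_row (y' j) * A) $$ (0, m) = z * z powi int j / u m * (mat_of_row (y j) * A) $$ (0, m)"
    if "j \<in> {1..r}" "m < n" for m j
  proof -
    have "(mat_of_row (y' j) * A) $$ (0, m) = (\<Sum>i<n. z powi int j / u i * y j $ i * A $$ (i, m))"
      using A that y' by (simp add: scalar_prod_def lessThan_atLeast0)
    also have "\<dots> = (\<Sum>i<n. z * z powi int j / u m * (y j $ i * A $$ (i, m)))"
    proof (rule sum.cong)
      fix i assume "i \<in> {..<n}"
      then have i: "i < n" by simp
      \<comment> \<open>The twine relation divided by \<open>u i * u m\<close>.\<close>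
      have "A $$ (i, m) / u i = z * A $$ (i, m) / u m"
        using twine[OF i that(2)] u[OF i] u[OF that(2)] by (simp add: field_simps)
      then have "z powi int j * y j $ i * (A $$ (i, m) / u i) =
          z powi int j * y j $ i * (z * A $$ (i, m) / u m)" by simp
      then show "z powi int j / u i * y j $ i * A $$ (i, m) =
          z * z powi int j / u m * (y j $ i * A $$ (i, m))"
        by (simp add: mult_ac)
    qed simp
    also have "\<dots> = z * z powi int j / u m * (mat_of_row (y j) * A) $$ (0, m)"
      using A that car[OF that(1)]
      by (simp add: scalar_prod_def lessThan_atLeast0 sum_distrib_left)
    finally show ?thesis .
  qed
  obtain i where i: "i < n" "y r $ i \<noteq> 0"
    using yr(1) car[of r] r by (metis atLeastAtMost_iff carrier_vecD eq_vecI index_zero_vec le_refl)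
  have "y' r $ i \<noteq> 0" using i y'[of r] r u \<open>z \<noteq> 0\<close> by simp
  then have ne: "y' r \<noteq> 0\<^sub>v n" using i by auto
  have last: "mat_of_row (y' r) * A = (\<mu> * z) \<cdot>\<^sub>m mat_of_row (y' r)"
  proof (rule eq_matI)
    fix i m assume "i < dim_row ((\<mu> * z) \<cdot>\<^sub>m mat_of_row (y' r))"
      and "m < dim_col ((\<mu> * z) \<cdot>\<^sub>m mat_of_row (y' r))"
    then have "i = 0" "m < n" using y'[of r] r by auto
    then show "(mat_of_row (y' r) * A) $$ (i, m) = ((\<mu> * z) \<cdot>\<^sub>m mat_of_row (y' r)) $$ (i, m)"
      using mult[of r m] r yr(2) y'[of r] car[of r] by simp
  qed (use A y'[of r] r in auto)
  have earlier: "mat_of_row (y' j) * A = (\<mu> * z) \<cdot>\<^sub>m mat_of_row (y' j) + mat_of_row (y' (j + 1))"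
    if j: "j \<in> {1..<r}" for j
  proof (rule eq_matI)
    have j': "j \<in> {1..r}" "j + 1 \<in> {1..r}" using j by auto
    fix i m
    assume "i < dim_row ((\<mu> * z) \<cdot>\<^sub>m mat_of_row (y' j) + mat_of_row (y' (j + 1)))"
      and "m < dim_col ((\<mu> * z) \<cdot>\<^sub>m mat_of_row (y' j) + mat_of_row (y' (j + 1)))"
    then have im: "i = 0" "m < n" using y'[OF j'(2)] by auto
    \<comment> \<open>Here the surplus \<open>z\<close> supplies the weight of the following vector
      \<open>y' (j + 1)\<close>.\<close>
    have "z powi int (j + 1) = z * z powi int j"
      using \<open>z \<noteq> 0\<close> by (simp add: power_int_add)
    then show "(mat_of_row (y' j) * A) $$ (i, m) =
        ((\<mu> * z) \<cdot>\<^sub>m mat_of_row (y' j) + mat_of_row (y' (j + 1))) $$ (i, m)"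
      using mult[OF j'(1) im(2)] im yj[OF j] y'[OF j'(1)] y'[OF j'(2)] car[OF j'(1)] car[OF j'(2)]
      by (simp add: algebra_simps add_divide_distrib)
  qed (use A y'[of j] y'[of "j + 1"] j in auto)
  show ?thesis
    unfolding left_jordan_chain_def using A r y' ne last earlier by auto
qed

theorem lemma4p1:
  fixes n h :: nat and \<omega> :: complex and A :: "complex mat" and \<pi> :: "nat \<Rightarrow> nat set"
    and \<alpha> :: "int \<Rightarrow> int \<Rightarrow> nat"
  assumes "h \<ge> 2"
    and "\<omega> = exp (2 * of_real pi * \<i> / of_nat h)"
    and "A \<in> carrier_mat n n"
    and "invertible_mat A"
    and "consecutive_partition n h \<pi>"
    and "h_cyclic n h \<pi> A"
    and "\<alpha> = cyc_diff h"
  shows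
    "(\<forall>\<mu> \<in> spectrum A. \<forall>(r::nat) (x :: nat \<Rightarrow> complex vec) (xb :: nat \<Rightarrow> nat \<Rightarrow> complex vec).
        right_jordan_chain A \<mu> r x \<and>
        (\<forall>j\<in>{1..r}. partitioned_conformably h \<pi> (x j) (\<lambda>i. xb i j)) \<longrightarrow>
        (\<forall>k\<in>{0..<h}. right_jordan_chain A (\<mu> * \<omega> ^ k) r
           (\<lambda>j. stack_vec h (\<lambda>i. (\<omega> ^ k) ^ \<alpha> (int i) (int j) \<cdot>\<^sub>v xb i j))))
     \<and>
     (\<forall>\<mu> \<in> spectrum A. \<forall>(r::nat) (y :: nat \<Rightarrow> complex vec) (yb :: nat \<Rightarrow> nat \<Rightarrow> complex vec).
        left_jordan_chain A \<mu> r y \<and>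
        (\<forall>j\<in>{1..r}. partitioned_conformably h \<pi> (y j) (\<lambda>i. yb j i)) \<longrightarrow>
        (\<forall>k\<in>{0..<h}. left_jordan_chain A (\<mu> * \<omega> ^ k) r
           (\<lambda>j. stack_vec h (\<lambda>i. (\<omega> ^ k) ^ \<alpha> (int j) (int i) \<cdot>\<^sub>v yb j i))))"
proof -
  have h: "h > 0" using assms(1) by simp
  have \<omega>h: "\<omega> ^ h = 1"
    using h unfolding assms(2) by (simp flip: exp_of_nat_mult)
  have part: "ordered_partition n h \<pi>"
    using assms(5) unfolding consecutive_partition_def by simp
  have "\<forall>i\<in>{0..<n}. \<exists>l\<in>{1..h}. i \<in> \<pi> l"
    using part unfolding ordered_partition_def by blast
  \<comment> \<open>\<open>p i\<close> is the number of the block containing the index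
    \<open>i\<close>; disjointness of the blocks makes it unique.\<close>
  then obtain p where p: "\<And>i. i < n \<Longrightarrow> p i \<in> {1..h} \<and> i \<in> \<pi> (p i)"
    by (metis atLeastLessThan_iff zero_le)
  have p_unique: "p i = l" if "i < n" "l \<in> {1..h}" "i \<in> \<pi> l" for i l
    using part p[OF that(1)] that(2,3) unfolding ordered_partition_def by blast
  have p_next: "p m = (if p i = h then 1 else p i + 1)"
    if im: "i < n" "m < n" "A $$ (i, m) \<noteq> 0" for i m
  proof -
    obtain l where l: "l \<in> {1..h}" "i \<in> \<pi> l" "m \<in> \<pi> (if l = h then 1 else l + 1)"
      using assms(6) im unfolding h_cyclic_def by blast
    moreover have "(if l = h then 1 else l + 1) \<in> {1..h}" using l(1) by auto
    ultimately show ?thesis using p_unique im by metis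
  qed
  \<comment> \<open>Brings the stacked vectors of the theorem into the entrywise form required by
    the two scaling lemmas.\<close>
  have stack: "stack_vec h (\<lambda>l. c l \<cdot>\<^sub>v b l) = vec n (\<lambda>i. c (p i) * v $ i)"
    if "partitioned_conformably h \<pi> v b" for v b and c :: "nat \<Rightarrow> complex"
  proof -
    have b: "\<And>l. l \<in> {1..h} \<Longrightarrow> b l \<in> carrier_vec (card (\<pi> l))" and v: "v = stack_vec h b"
      using that unfolding partitioned_conformably_def by auto
    have "stack_vec h (\<lambda>l. c l \<cdot>\<^sub>v b l) \<in> carrier_vec n"
      by (rule consecutive_partition_stack_vec(1)[OF assms(5)]) (use b in simp)
    then show ?thesis
      using consecutive_partition_stack_vec(2)[OF assms(5) b] p v by (intro eq_vecI) auto
  qed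
  have z: "z ^ h = 1" "z \<noteq> 0" if "z = \<omega> ^ k" for z k
  proof -
    show "z ^ h = 1" using \<omega>h that by (metis mult.commute power_mult power_one)
    then show "z \<noteq> 0" using h by (auto simp: power_0_left)
  qed
  \<comment> \<open>The diagonal weights are \<open>u i = z ^ p i\<close>. A nonzero entry raises
    the block number by one, which costs one factor \<open>z\<close>; at the wrap-around from block
    \<open>h\<close> to block 1 the equation is \<open>z = z * z ^ h\<close>, which is where
    \<open>z ^ h = 1\<close> enters.\<close>
  have twine: "A $$ (i, m) * z ^ p m = z * z ^ p i * A $$ (i, m)"
    if "i < n" "m < n" "z ^ h = 1" for i m z
    using p_next[OF that(1,2)] that(3) by (cases "A $$ (i, m) = 0") (auto split: if_splits)
  show ?thesis
  proof (intro conjI ballI allI impI; elim conjE)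
    fix \<mu> r x xb k
    assume chain: "right_jordan_chain A \<mu> r x"
      and conf: "\<forall>j\<in>{1..r}. partitioned_conformably h \<pi> (x j) (\<lambda>i. xb i j)"
    define z where "z = \<omega> ^ k"
    note z = z[OF z_def]
    have "right_jordan_chain A (\<mu> * z) r
        (\<lambda>j. stack_vec h (\<lambda>i. z ^ \<alpha> (int i) (int j) \<cdot>\<^sub>v xb i j))"
    \<comment> \<open>The exponent \<open>\<alpha> (p i) j\<close> agrees with
      \<open>p i - j\<close> modulo \<open>h\<close>, so the factor is
      \<open>z powi (- int j)\<close> times the weight \<open>z ^ p i\<close>.\<close>
    proof (rule right_jordan_chain_scale[OF assms(3) z(2) _ twine[OF _ _ z(1)] chain])
      fix j assume "j \<in> {1..r}"
      then show "stack_vec h (\<lambda>i. z ^ \<alpha> (int i) (int j) \<cdot>\<^sub>v xb i j) =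
          vec n (\<lambda>i. z powi (- int j) * z ^ p i * x j $ i)"
        using stack[of "x j" "\<lambda>i. xb i j" "\<lambda>i. z ^ \<alpha> (int i) (int j)"] conf z(2)
        by (simp add: assms(7) power_cyc_diff[OF h z(1)] power_int_diff power_int_minus field_simps)
    qed (use z in auto)
    then show "right_jordan_chain A (\<mu> * \<omega> ^ k) r
        (\<lambda>j. stack_vec h (\<lambda>i. (\<omega> ^ k) ^ \<alpha> (int i) (int j) \<cdot>\<^sub>v xb i j))"
      unfolding z_def .
  next
    fix \<mu> r y yb k
    assume chain: "left_jordan_chain A \<mu> r y"
      and conf: "\<forall>j\<in>{1..r}. partitioned_conformably h \<pi> (y j) (\<lambda>i. yb j i)"
    define z where "z = \<omega> ^ k"
    note z = z[OF z_def]
    have "left_jordan_chain A (\<mu> * z) r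
        (\<lambda>j. stack_vec h (\<lambda>i. z ^ \<alpha> (int j) (int i) \<cdot>\<^sub>v yb j i))"
    \<comment> \<open>The arguments of \<open>\<alpha>\<close> are swapped here, so the exponent is
      \<open>j - p i\<close> modulo \<open>h\<close> and the weight \<open>z ^ p i\<close> appears
      in the denominator.\<close>
    proof (rule left_jordan_chain_scale[OF assms(3) z(2) _ twine[OF _ _ z(1)] chain])
      fix j assume "j \<in> {1..r}"
      then show "stack_vec h (\<lambda>i. z ^ \<alpha> (int j) (int i) \<cdot>\<^sub>v yb j i) =
          vec n (\<lambda>i. z powi int j / z ^ p i * y j $ i)"
        using stack[of "y j" "\<lambda>i. yb j i" "\<lambda>i. z ^ \<alpha> (int j) (int i)"] conf z(2)
        by (simp add: assms(7) power_cyc_diff[OF h z(1)] power_int_diff)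
    qed (use z in auto)
    then show "left_jordan_chain A (\<mu> * \<omega> ^ k) r
        (\<lambda>j. stack_vec h (\<lambda>i. (\<omega> ^ k) ^ \<alpha> (int j) (int i) \<cdot>\<^sub>v yb j i))"
      unfolding z_def .
  qed
qed

end
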